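(* Let $\mathcal{J}:\mathbb{R}^n\to\mathbb{R}\cup\{\infty\}$ be proper, coercive, lower semi-continuous, and continuous on its domain, with convex $\operatorname{dom}\mathcal{J}$. Let $\mathcal{J}$ be block-separable nonsmooth with respect to $R=(R_1,\dots,R_m)$, and let the decomposition $\mathbb{R}^n=\sum_{k=1}^mV_k$ be induced by the block structure, i.e. $V_k=(\ker R_k)^\perp$ for $k=1,\dots,m$. Let $V=V_k$ for some $k$, and let $\mathcal{M}^{\mathrm{ex}}:\operatorname{dom}\mathcal{J}\to\operatorname{dom}\mathcal{J}$ be the exact minimization operator, i.e. $\mathcal{M}^{\mathrm{ex}}(w)$ is a (any) global minimizer of $\mathcal{J}$ in $w+V$ for each $w\in\operatorname{dom}\mathcal{J}$. Then $\mathcal{M}=\tilde{\mathcal{M}}=\mathcal{M}^{\mathrm{ex}}$ satisfies: 1. (Monotonicity) $\mathcal{J}(\mathcal{M}(w))\le\mathcal{J}(\tilde{\mathcal{M}}(w))\le\mathcal{J}(w)$ for all $w\in\operatorname{dom}\mathcal{J}$; 2. (Continuity) $\mathcal{J}\circ\tilde{\mathcal{M}}$ is continuous on $\operatorname{dom}\mathcal{J}$; 3. (Stability) $\mathcal{J}(\tilde{\mathcal{M}}(w))<\mathcal{J}(w)$ for every $w\in\operatorname{dom}\mathcal{J}$ such that $\mathcal{J}(w)$ is not minimal in $w+V$. In particular, the minimal energy $\mathcal{J}\circ\mathcal{M}^{\mathrm{ex}}$ is continuous on $\operatorname{dom}\mathcal{J}$.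
   Context: $\operatorname{dom}\mathcal{J}=\{x : \mathcal{J}(x)<\infty\}$, with the topology induced from $\mathbb{R}^n$. Coercive means $\mathcal{J}(v)\to\infty$ as $\|v\|\to\infty$. "Continuous on its domain" means that the restriction of $\mathcal{J}$ to $\operatorname{dom}\mathcal{J}$ is continuous. Block-separable nonsmooth: $R=(R_1,\dots,R_m):\mathbb{R}^n\to\prod_{k=1}^m\mathbb{R}^{N_k}$ is a linear isomorphism with surjective linear components $R_k:\mathbb{R}^n\to\mathbb{R}^{N_k}$; and there are a continuously differentiable $\mathcal{J}_0:\mathbb{R}^n\to\mathbb{R}$ and convex, proper, lower semi-continuous $\varphi_k:\mathbb{R}^{N_k}\to\mathbb{R}\cup\{\infty\}$ with $\mathcal{J}(v)=\mathcal{J}_0(v)+\sum_{k=1}^m\varphi_k(R_kv)$ for all $v\in\mathbb{R}^n$.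
   Formalization: With the Euclidean complement, continuity can fail for general R. Here the complement V_k of ker R_k is taken in the inner product sum_k (R_k x)·(R_k y) induced by R, so V_k is the set of displacements changing only block k; for mutually orthogonal blocks this is the Euclidean complement. *)

theory Defs
  imports "HOL-Analysis.Analysis"
begin

text \<open>
  Functions with values in \<open>\<real> \<union> {\<infinity>}\<close> are \<open>ereal\<close>-valued; the value \<open>-\<infinity>\<close> is excluded
  by \<open>proper_on\<close>. The space \<open>\<real>\<^sup>N\<close> for a dimension \<open>N\<close> that varies with the block is the library's
  \<open>Euclidean_space N\<close>, whose points are the functions \<open>nat \<Rightarrow> real\<close> vanishing on \<open>{N..}\<close>.
\<close>

definition effdom :: "('a \<Rightarrow> ereal) \<Rightarrow> 'a set" where
  "effdom J = {x. J x < \<infinity>}"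

definition proper_on :: "'a set \<Rightarrow> ('a \<Rightarrow> ereal) \<Rightarrow> bool" where
  "proper_on S f \<longleftrightarrow> (\<forall>x\<in>S. f x \<noteq> -\<infinity>) \<and> (\<exists>x\<in>S. f x < \<infinity>)"

definition lsc_map :: "'a topology \<Rightarrow> ('a \<Rightarrow> ereal) \<Rightarrow> bool" where
  "lsc_map X f \<longleftrightarrow> (\<forall>a. openin X {x \<in> topspace X. a < f x})"

definition coercive :: "('a::real_normed_vector \<Rightarrow> ereal) \<Rightarrow> bool" where
  "coercive J \<longleftrightarrow> (J \<longlongrightarrow> \<infinity>) at_infinity"

definition convex_fun_Rn :: "nat \<Rightarrow> ((nat \<Rightarrow> real) \<Rightarrow> ereal) \<Rightarrow> bool" where
  "convex_fun_Rn N f \<longleftrightarrow>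
     (\<forall>x \<in> topspace (Euclidean_space N). \<forall>y \<in> topspace (Euclidean_space N). \<forall>u v.
        0 \<le> u \<longrightarrow> 0 \<le> v \<longrightarrow> u + v = 1 \<longrightarrow>
        f (\<lambda>i. u * x i + v * y i) \<le> ereal u * f x + ereal v * f y)"

definition continuously_differentiable :: "('a::euclidean_space \<Rightarrow> real) \<Rightarrow> bool" where
  "continuously_differentiable f \<longleftrightarrow>
     (\<exists>f'. (\<forall>x. (f has_derivative blinfun_apply (f' x)) (at x)) \<and> continuous_on UNIV f')"

definition block_structure ::
  "nat \<Rightarrow> (nat \<Rightarrow> nat) \<Rightarrow> (nat \<Rightarrow> 'a::euclidean_space \<Rightarrow> nat \<Rightarrow> real) \<Rightarrow> bool" where
  "block_structure m N R \<longleftrightarrow>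
     (\<forall>k\<in>{1..m}. (\<forall>i. linear (\<lambda>x. R k x i)) \<and> range (R k) = topspace (Euclidean_space (N k))) \<and>
     bij_betw (\<lambda>x. \<lambda>k\<in>{1..m}. R k x) UNIV (\<Pi>\<^sub>E k\<in>{1..m}. topspace (Euclidean_space (N k)))"

definition block_separable_nonsmooth ::
  "nat \<Rightarrow> (nat \<Rightarrow> nat) \<Rightarrow> (nat \<Rightarrow> 'a::euclidean_space \<Rightarrow> nat \<Rightarrow> real) \<Rightarrow> ('a \<Rightarrow> ereal) \<Rightarrow> bool" where
  "block_separable_nonsmooth m N R J \<longleftrightarrow>
     block_structure m N R \<and>
     (\<exists>J0 \<phi>. continuously_differentiable J0 \<and>
        (\<forall>k\<in>{1..m}. convex_fun_Rn (N k) (\<phi> k) \<and>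
           proper_on (topspace (Euclidean_space (N k))) (\<phi> k) \<and>
           lsc_map (Euclidean_space (N k)) (\<phi> k)) \<and>
        (\<forall>v. J v = ereal (J0 v) + (\<Sum>k\<in>{1..m}. \<phi> k (R k v))))"

definition block_ker :: "(nat \<Rightarrow> 'a \<Rightarrow> nat \<Rightarrow> real) \<Rightarrow> nat \<Rightarrow> 'a set" where
  "block_ker R k = {x. R k x = (\<lambda>i. 0)}"

text \<open>
  The complement \<open>V\<^sub>k = (ker R\<^sub>k)\<^sup>\<bottom>\<close> is taken with respect to the inner product induced by the block
  structure, i.e. the standard inner product of the product of the \<open>\<real>\<^bsup>N k\<^esup>\<close> carried over to the
  ambient space by the isomorphism \<open>R\<close>. It is the standard Euclidean complement exactly when the
  Euclidean complements of all the kernels are mutually orthogonal (one direction is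
  \<open>orthogonal_comp_block_ker\<close> below; \<open>block_space_eq\<close> gives the other).

  The Euclidean complement cannot be used for all \<open>R\<close>: a displacement in it may change the other
  components \<open>R\<^sub>j\<close>, and then the minimal energy may be discontinuous. For instance let
  \<open>R\<^sub>1 (a,b,c,s) = (a,b,c+s)\<close>, \<open>R\<^sub>2 (a,b,c,s) = s\<close>, let \<open>J\<close> have the value \<open>s\<close> where
  \<open>R\<^sub>1 (a,b,c,s) \<in> {(a,b,t). 0 \<le> a \<le> 1, 0 \<le> t \<le> 1, b\<^sup>2 \<le> a t}\<close> and \<open>s \<in> {-1..1}\<close>, and \<open>\<infinity>\<close>
  elsewhere. The Euclidean complement of \<open>ker R\<^sub>2\<close> is the \<open>s\<close>-axis; along it, the minimal energy is
  \<open>0\<close> at the points \<open>(b\<^sup>2,b,1,0)\<close> with \<open>0 < b \<le> 1\<close>, but \<open>-1\<close> at their limit \<open>(0,0,1,0)\<close>.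
\<close>

definition block_inner ::
  "nat \<Rightarrow> (nat \<Rightarrow> nat) \<Rightarrow> (nat \<Rightarrow> 'a \<Rightarrow> nat \<Rightarrow> real) \<Rightarrow> 'a \<Rightarrow> 'a \<Rightarrow> real" where
  "block_inner m N R x y = (\<Sum>k\<in>{1..m}. \<Sum>i<N k. R k x i * R k y i)"

definition block_space ::
  "nat \<Rightarrow> (nat \<Rightarrow> nat) \<Rightarrow> (nat \<Rightarrow> 'a \<Rightarrow> nat \<Rightarrow> real) \<Rightarrow> nat \<Rightarrow> 'a set" where
  "block_space m N R k = {v. \<forall>u \<in> block_ker R k. block_inner m N R u v = 0}"

definition global_minimizer_in :: "('a \<Rightarrow> ereal) \<Rightarrow> 'a set \<Rightarrow> 'a \<Rightarrow> bool" where
  "global_minimizer_in J S x \<longleftrightarrow> is_arg_min J (\<lambda>y. y \<in> S) x"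

text \<open>The translate \<open>w + V\<close> is written as the image \<open>(+) w ` V\<close>.\<close>

definition exact_minimization ::
  "('a::real_vector \<Rightarrow> ereal) \<Rightarrow> 'a set \<Rightarrow> ('a \<Rightarrow> 'a) \<Rightarrow> bool" where
  "exact_minimization J V M \<longleftrightarrow>
     M \<in> effdom J \<rightarrow> effdom J \<and> (\<forall>w\<in>effdom J. global_minimizer_in J ((+) w ` V) (M w))"

definition op_monotone :: "('a \<Rightarrow> ereal) \<Rightarrow> ('a \<Rightarrow> 'a) \<Rightarrow> ('a \<Rightarrow> 'a) \<Rightarrow> bool" where
  "op_monotone J M M' \<longleftrightarrow> (\<forall>w\<in>effdom J. J (M w) \<le> J (M' w) \<and> J (M' w) \<le> J w)"

definition op_continuous :: "('a::topological_space \<Rightarrow> ereal) \<Rightarrow> ('a \<Rightarrow> 'a) \<Rightarrow> bool" where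
  "op_continuous J M' \<longleftrightarrow> continuous_on (effdom J) (J \<circ> M')"

definition op_stable :: "('a::real_vector \<Rightarrow> ereal) \<Rightarrow> 'a set \<Rightarrow> ('a \<Rightarrow> 'a) \<Rightarrow> bool" where
  "op_stable J V M' \<longleftrightarrow>
     (\<forall>w\<in>effdom J. \<not> global_minimizer_in J ((+) w ` V) w \<longrightarrow> J (M' w) < J w)"

lemma block_structure_zero:
  assumes "block_structure m N R" "k \<in> {1..m}" "\<not> i < N k"
  shows "R k x i = 0"
proof -
  have "R k x \<in> topspace (Euclidean_space (N k))"
    using assms(1,2) unfolding block_structure_def by blast
  then show ?thesis using assms(3) by (auto simp: topspace_Euclidean_space)
qed

lemma block_structure_inj:
  assumes "block_structure m N R" "\<And>k. k \<in> {1..m} \<Longrightarrow> x \<in> block_ker R k"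
  shows "x = 0"
proof -
  have "R k 0 = (\<lambda>i. 0)" if "k \<in> {1..m}" for k
    using assms(1) that linear_0[of "\<lambda>x. R k x i" for i] by (auto simp: block_structure_def)
  then have "(\<lambda>k\<in>{1..m}. R k x) = (\<lambda>k\<in>{1..m}. R k 0)"
    using assms(2) by (auto simp: block_ker_def fun_eq_iff)
  then show ?thesis
    using assms(1) unfolding block_structure_def bij_betw_def by (auto dest: injD)
qed

lemma block_space_eq:
  assumes R: "block_structure m N R" and k: "k \<in> {1..m}"
  shows "block_space m N R k = (\<Inter>j\<in>{1..m} - {k}. block_ker R j)"
proof (intro equalityI subsetI)
  fix v assume v: "v \<in> block_space m N R k"
  let ?P = "\<Pi>\<^sub>E k\<in>{1..m}. topspace (Euclidean_space (N k))"
  let ?g = "\<lambda>j\<in>{1..m}. if j = k then (\<lambda>i. 0) else R j v"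
  have "?g \<in> ?P"
    using R by (auto simp: topspace_Euclidean_space block_structure_zero)
  moreover have "?P = range (\<lambda>x. \<lambda>k\<in>{1..m}. R k x)"
    using R unfolding block_structure_def bij_betw_def by simp
  ultimately have "?g \<in> range (\<lambda>x. \<lambda>k\<in>{1..m}. R k x)" by (rule subst[rotated])
  then obtain u where g: "?g = (\<lambda>k\<in>{1..m}. R k u)" by (rule imageE)
  have u: "R j u = (if j = k then (\<lambda>i. 0) else R j v)" if "j \<in> {1..m}" for j
    using fun_cong[OF g, of j] that by (simp only: restrict_apply if_True)
  have "u \<in> block_ker R k" using u[OF k] by (simp add: block_ker_def)
  then have "block_inner m N R u v = 0" using v by (auto simp: block_space_def)
  moreover have "block_inner m N R u v = (\<Sum>j\<in>{1..m}. \<Sum>i<N j. R j u i * R j u i)"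
    unfolding block_inner_def by (intro sum.cong refl) (auto simp: u)
  ultimately have "(\<Sum>j\<in>{1..m}. \<Sum>i<N j. R j u i * R j u i) = 0" by simp
  then have z: "\<forall>j\<in>{1..m}. \<forall>i<N j. R j u i = 0"
    by (simp add: sum_nonneg_eq_0_iff sum_nonneg)
  show "v \<in> (\<Inter>j\<in>{1..m} - {k}. block_ker R j)"
  proof
    fix j assume j: "j \<in> {1..m} - {k}"
    then have "R j v i = 0" for i
      using z u[of j] block_structure_zero[OF R, of j i v] by (metis DiffE singletonI)
    then show "v \<in> block_ker R j" by (auto simp: block_ker_def)
  qed
next
  fix v assume "v \<in> (\<Inter>j\<in>{1..m} - {k}. block_ker R j)"
  then have "R j u i * R j v i = 0" if "j \<in> {1..m}" "u \<in> block_ker R k" for j i u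
    using that by (cases "j = k") (auto simp: block_ker_def)
  then have "block_inner m N R u v = 0" if "u \<in> block_ker R k" for u
    using that unfolding block_inner_def by (intro sum.neutral ballI) blast
  then show "v \<in> block_space m N R k" by (simp add: block_space_def)
qed

lemma orthogonal_comp_block_ker:
  assumes R: "block_structure m N R" and k: "k \<in> {1..m}"
    and orth: "\<And>j x y. \<lbrakk>j \<in> {1..m}; j \<noteq> k; x \<in> (block_ker R j)\<^sup>\<bottom>; y \<in> (block_ker R k)\<^sup>\<bottom>\<rbrakk>
                 \<Longrightarrow> orthogonal x y"
  shows "(block_ker R k)\<^sup>\<bottom> = block_space m N R k"
proof -
  have sub: "subspace (block_ker R j)" if "j \<in> {1..m}" for j
  proof -
    have l: "linear (\<lambda>x. R j x i)" for i using R that by (auto simp: block_structure_def)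
    show ?thesis
      unfolding subspace_def block_ker_def
      using linear_0[OF l] linear_add[OF l] linear_cmul[OF l] by (auto simp: fun_eq_iff)
  qed
  have le: "(block_ker R k)\<^sup>\<bottom> \<subseteq> (\<Inter>j\<in>{1..m} - {k}. block_ker R j)"
  proof (intro subsetI INT_I)
    fix y j assume y: "y \<in> (block_ker R k)\<^sup>\<bottom>" and j: "j \<in> {1..m} - {k}"
    have "y \<in> (block_ker R j)\<^sup>\<bottom>\<^sup>\<bottom>"
      using orth y j by (auto simp: orthogonal_comp_def)
    then show "y \<in> block_ker R j" using orthogonal_comp_self sub j by auto
  qed
  have ge: "x \<in> (block_ker R k)\<^sup>\<bottom>" if x: "x \<in> (\<Inter>j\<in>{1..m} - {k}. block_ker R j)" for x
  proof -
    obtain b a where b: "b \<in> block_ker R k" and a: "\<And>w. w \<in> block_ker R k \<Longrightarrow> orthogonal a w"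
      and xab: "x = b + a"
      using orthogonal_subspace_decomp_exists[of "block_ker R k" x]
      by (metis sub[OF k] span_eq_iff)
    have aC: "a \<in> (block_ker R k)\<^sup>\<bottom>"
      using a by (auto simp: orthogonal_comp_def orthogonal_commute)
    have "b \<in> block_ker R j" if j: "j \<in> {1..m}" for j
    proof (cases "j = k")
      case False
      then have "x \<in> block_ker R j" "a \<in> block_ker R j" using x aC le j by auto
      then show ?thesis using subspace_diff[OF sub[OF j], of x a] xab by simp
    qed (use b in simp)
    then have "b = 0" using block_structure_inj[OF R] by blast
    then show ?thesis using aC xab by simp
  qed
  show ?thesis using le ge block_space_eq[OF R k] by auto
qed

end

theory Submission
  imports Defs
begin

text \<open>
  Let \<open>g w\<close> be the minimum of \<open>J\<close> on \<open>w + V\<close>. Its sublevel sets are the sums of \<open>V\<close> and the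
  compact sublevel sets of \<open>J\<close>, hence closed, so \<open>g\<close> is lower semicontinuous. For the upper
  semicontinuity at \<open>w\<close>, with a minimizer \<open>z \<in> w + V\<close>, replace the \<open>k\<close>-th block of a nearby
  \<open>w' \<in> dom J\<close> by that of \<open>z\<close>. Membership in \<open>dom J\<close> is decided block by block, so the resulting
  point stays in \<open>dom J\<close>; it depends continuously on \<open>w'\<close> and lies in \<open>w' + V\<close>, and it equals \<open>z\<close>
  for \<open>w' = w\<close>. Continuity of \<open>J\<close> on \<open>dom J\<close> then bounds \<open>g w'\<close> from above.
\<close>

lemma block_structure_linear:
  assumes "block_structure m N R" "j \<in> {1..m}"
  shows "linear (\<lambda>x. R j x i)"
  using assms by (auto simp: block_structure_def)

lemma
  assumes "block_structure m N R" "j \<in> {1..m}"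
  shows block_structure_add: "R j (x + y) = (\<lambda>i. R j x i + R j y i)"
    and block_structure_diff: "R j (x - y) = (\<lambda>i. R j x i - R j y i)"
    and block_structure_scaleR: "R j (c *\<^sub>R x) = (\<lambda>i. c * R j x i)"
    and block_structure_0: "R j 0 = (\<lambda>i. 0)"
  using linear_add[OF block_structure_linear[OF assms]] linear_diff[OF block_structure_linear[OF assms]]
    linear_cmul[OF block_structure_linear[OF assms]] linear_0[OF block_structure_linear[OF assms]]
  by (auto simp: fun_eq_iff)

lemma block_structure_eqI:
  assumes R: "block_structure m N R" and eq: "\<And>j. j \<in> {1..m} \<Longrightarrow> R j x = R j y"
  shows "x = y"
proof -
  have "(\<lambda>j\<in>{1..m}. R j x) = (\<lambda>j\<in>{1..m}. R j y)"
    using eq by auto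
  then show ?thesis
    using R unfolding block_structure_def bij_betw_def by (auto dest: injD)
qed

lemma block_structure_ex:
  assumes R: "block_structure m N R" and b: "\<And>j. j \<in> {1..m} \<Longrightarrow> b j \<in> topspace (Euclidean_space (N j))"
  obtains x where "\<And>j. j \<in> {1..m} \<Longrightarrow> R j x = b j"
proof -
  have "range (\<lambda>x. \<lambda>j\<in>{1..m}. R j x) = (\<Pi>\<^sub>E j\<in>{1..m}. topspace (Euclidean_space (N j)))"
    using R unfolding block_structure_def bij_betw_def by simp
  moreover have "restrict b {1..m} \<in> (\<Pi>\<^sub>E j\<in>{1..m}. topspace (Euclidean_space (N j)))"
    using b by simp
  ultimately obtain x where x: "restrict b {1..m} = (\<lambda>j\<in>{1..m}. R j x)"
    by (metis (no_types, lifting) imageE)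
  have "R j x = b j" if "j \<in> {1..m}" for j
    using fun_cong[OF x, of j] that by (simp only: restrict_apply if_True)
  then show thesis by (rule that)
qed

text \<open>Surjectivity of \<open>R\<close> onto the product of the blocks provides the values of
  \<open>P\<close>. Injectivity determines each value by its blocks, which is why \<open>P\<close>
  is linear.\<close>

lemma block_projection:
  assumes R: "block_structure m N R" and k: "k \<in> {1..m}"
  obtains P where "linear P"
    "\<And>x j. j \<in> {1..m} \<Longrightarrow> R j (P x) = (if j = k then R k x else (\<lambda>i. 0))"
proof -
  have "\<exists>y. \<forall>j\<in>{1..m}. R j y = (if j = k then R k x else (\<lambda>i. 0))" for x
  proof -
    have "(if j = k then R k x else (\<lambda>i. 0)) \<in> topspace (Euclidean_space (N j))" for j
      using block_structure_zero[OF R k] by (auto simp: topspace_Euclidean_space)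
    then obtain y where "\<And>j. j \<in> {1..m} \<Longrightarrow> R j y = (if j = k then R k x else (\<lambda>i. 0))"
      by (rule block_structure_ex[OF R]) blast
    then show ?thesis by blast
  qed
  then obtain P where P: "\<And>x j. j \<in> {1..m} \<Longrightarrow> R j (P x) = (if j = k then R k x else (\<lambda>i. 0))"
    by metis
  have "linear P"
  proof (rule linearI)
    fix x y and c :: real
    show "P (x + y) = P x + P y"
      by (rule block_structure_eqI[OF R])
        (simp add: P fun_eq_iff block_structure_add[OF R] k)
    show "P (c *\<^sub>R x) = c *\<^sub>R P x"
      by (rule block_structure_eqI[OF R])
        (simp add: P fun_eq_iff block_structure_scaleR[OF R] k)
  qed
  then show thesis using P by (rule that)
qed

lemma mem_block_space_iff:
  assumes R: "block_structure m N R" and k: "k \<in> {1..m}"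
  shows "v \<in> block_space m N R k \<longleftrightarrow> (\<forall>j\<in>{1..m} - {k}. R j v = (\<lambda>i. 0))"
  by (simp add: block_space_eq[OF R k] block_ker_def)

lemma subspace_block_space:
  assumes R: "block_structure m N R" and k: "k \<in> {1..m}"
  shows "subspace (block_space m N R k)"
  by (auto simp: subspace_def mem_block_space_iff[OF R k] block_structure_0[OF R] block_structure_add[OF R] block_structure_scaleR[OF R])

text \<open>Supplies competitors for the upper bound on the minimal energy: moving only inside its
  own coset, every \<open>x\<close> receives the \<open>k\<close>-th block of the fixed point
  \<open>z\<close>.\<close>

lemma block_exchange:
  assumes R: "block_structure m N R" and k: "k \<in> {1..m}"
  obtains T where "continuous_on UNIV T"
    "\<And>x j. j \<in> {1..m} \<Longrightarrow> R j (T x) = R j (if j = k then z else x)"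
    "\<And>x. T x \<in> (+) x ` block_space m N R k"
proof -
  obtain P where P: "linear P"
    "\<And>x j. j \<in> {1..m} \<Longrightarrow> R j (P x) = (if j = k then R k x else (\<lambda>i. 0))"
    by (rule block_projection[OF R k]) blast
  show thesis
  proof (rule that)
    \<comment> \<open>Since \<open>P\<close> keeps block \<open>k\<close> and kills the others,
      adding \<open>P (z - x)\<close> overwrites block \<open>k\<close> of \<open>x\<close> by that
      of \<open>z\<close>.\<close>
    show "continuous_on UNIV (\<lambda>x. x + P (z - x))"
      by (intro continuous_intros linear_continuous_on_compose[OF _ P(1)])
    show "R j (x + P (z - x)) = R j (if j = k then z else x)" if j: "j \<in> {1..m}" for x j
      using j by (auto simp: P(2) fun_eq_iff block_structure_add[OF R] block_structure_diff[OF R])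
    show "x + P (z - x) \<in> (+) x ` block_space m N R k" for x
      using P(2) by (auto simp: mem_block_space_iff[OF R k])
  qed
qed

text \<open>A finite sum in \<open>ereal\<close> is \<infinity> iff one of its summands is, so
  finiteness of \<open>J\<close> splits into separate conditions on the blocks.\<close>

lemma block_separable_effdom:
  assumes "block_separable_nonsmooth m N R J"
  obtains D where "\<And>v. v \<in> effdom J \<longleftrightarrow> (\<forall>j\<in>{1..m}. R j v \<in> D j)"
proof -
  obtain J0 \<phi> where J: "\<And>v. J v = ereal (J0 v) + (\<Sum>j\<in>{1..m}. \<phi> j (R j v))"
    using assms unfolding block_separable_nonsmooth_def by metis
  have "v \<in> effdom J \<longleftrightarrow> (\<forall>j\<in>{1..m}. R j v \<in> {x. \<phi> j x \<noteq> \<infinity>})" for v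
    by (auto simp: effdom_def J sum_Pinfty)
  then show thesis by (rule that)
qed

text \<open>Coercivity bounds the sublevel set, as \<open>c\<close> is below \<infinity>; lower
  semicontinuity closes it.\<close>

lemma compact_sublevel:
  fixes J :: "'a::euclidean_space \<Rightarrow> ereal"
  assumes "coercive J" "lsc_map euclidean J" "c < \<infinity>"
  shows "compact {y. J y \<le> c}"
proof -
  have "\<forall>\<^sub>F x in at_infinity. c < J x"
    using assms(1,3) unfolding coercive_def by (rule order_tendstoD)
  then obtain b where "\<And>x. b \<le> norm x \<Longrightarrow> c < J x"
    by (auto simp: eventually_at_infinity)
  then have "bounded {y. J y \<le> c}"
    unfolding bounded_iff by (intro exI[of _ b]) (force simp: not_le[symmetric])
  moreover have "open {y. c < J y}"
    using assms(2) by (simp add: lsc_map_def)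
  then have "closed {y. J y \<le> c}"
    by (simp add: closed_def Compl_eq not_le)
  ultimately show ?thesis by (simp add: compact_eq_bounded_closed)
qed

text \<open>The set is the Minkowski sum of a compact sublevel set and \<open>V\<close>; compactness
  of one summand keeps a sum of closed sets closed.\<close>

lemma closed_marginal_sublevel:
  fixes J :: "'a::euclidean_space \<Rightarrow> ereal"
  assumes "coercive J" "lsc_map euclidean J" "subspace V" "c < \<infinity>"
  shows "closed {w. \<exists>y \<in> (+) w ` V. J y \<le> c}"
proof -
  have "closed (\<Union>y\<in>{y. J y \<le> c}. \<Union>v\<in>V. {y + v})"
    using assms by (intro compact_closed_sums compact_sublevel closed_subspace)
  \<comment> \<open>Solving \<open>w = y + v\<close> for \<open>y\<close> turns \<open>v\<close>
    into \<open>- v\<close>, which stays in the subspace.\<close>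
  moreover have "(\<Union>y\<in>{y. J y \<le> c}. \<Union>v\<in>V. {y + v}) = {w. \<exists>y \<in> (+) w ` V. J y \<le> c}"
  proof (intro equalityI subsetI)
    fix w assume "w \<in> (\<Union>y\<in>{y. J y \<le> c}. \<Union>v\<in>V. {y + v})"
    then obtain y v where "J y \<le> c" "v \<in> V" "w = y + v" by auto
    then show "w \<in> {w. \<exists>y \<in> (+) w ` V. J y \<le> c}"
      using subspace_neg[OF assms(3), of v] by (auto intro!: bexI[of _ "- v"])
  next
    fix w assume "w \<in> {w. \<exists>y \<in> (+) w ` V. J y \<le> c}"
    then obtain v where "J (w + v) \<le> c" "v \<in> V" by auto
    then show "w \<in> (\<Union>y\<in>{y. J y \<le> c}. \<Union>v\<in>V. {y + v})"
      using subspace_neg[OF assms(3), of v]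
      by (auto intro!: exI[of _ "w + v"] bexI[of _ "- v"])
  qed
  ultimately show ?thesis by simp
qed

lemma exact_minimization_le:
  assumes "exact_minimization J V M" "w \<in> effdom J" "y \<in> (+) w ` V"
  shows "J (M w) \<le> J y"
  using assms by (auto simp: exact_minimization_def global_minimizer_in_def is_arg_min_linorder)

lemma exact_minimization_mem:
  assumes "exact_minimization J V M" "w \<in> effdom J"
  shows "M w \<in> (+) w ` V" "M w \<in> effdom J"
  using assms by (auto simp: exact_minimization_def global_minimizer_in_def is_arg_min_def)

lemma continuous_on_minimal_energy:
  fixes J :: "'a::euclidean_space \<Rightarrow> ereal"
  assumes "coercive J" "lsc_map euclidean J" and cont: "continuous_on (effdom J) J"
    and sep: "block_separable_nonsmooth m N R J" and k: "k \<in> {1..m}"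
    and M: "exact_minimization J (block_space m N R k) M"
  shows "continuous_on (effdom J) (\<lambda>w. J (M w))"
  unfolding continuous_on_def
proof
  fix w assume w: "w \<in> effdom J"
  let ?V = "block_space m N R k" and ?F = "at w within effdom J"
  have R: "block_structure m N R"
    using sep by (simp add: block_separable_nonsmooth_def)
  have dom: "\<forall>\<^sub>F w' in ?F. w' \<in> effdom J"
    by (simp add: eventually_at_filter)
  show "((\<lambda>w. J (M w)) \<longlongrightarrow> J (M w)) ?F"
  proof (rule order_tendstoI)
    \<comment> \<open>Lower bound: no point of \<open>w + V\<close> reaches level \<open>c\<close>,
      so \<open>w\<close> lies in the open complement of \<open>?L\<close>, and so do all nearby
      points.\<close>
    fix c assume c: "c < J (M w)"
    let ?L = "{w. \<exists>y \<in> (+) w ` ?V. J y \<le> c}"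
    have "closed ?L"
      using assms(1,2) subspace_block_space[OF R k] c by (intro closed_marginal_sublevel) auto
    moreover have "w \<notin> ?L"
      using exact_minimization_le[OF M w] c by force
    ultimately have "\<forall>\<^sub>F w' in ?F. w' \<in> - ?L"
      by (intro topological_tendstoD[OF tendsto_ident_at]) auto
    with dom show "\<forall>\<^sub>F w' in ?F. c < J (M w')"
    proof eventually_elim
      case (elim w')
      then show ?case using exact_minimization_mem(1)[OF M, of w'] not_le by blast
    qed
  next
    \<comment> \<open>Upper bound: \<open>T w'\<close> competes with \<open>M w'\<close>, and
      \<open>J (T w')\<close> tends to \<open>J (M w)\<close> as \<open>w'\<close> tends to
      \<open>w\<close>.\<close>
    fix c assume c: "J (M w) < c"
    obtain T where T: "continuous_on UNIV T"
      "\<And>x j. j \<in> {1..m} \<Longrightarrow> R j (T x) = R j (if j = k then M w else x)"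
      "\<And>x. T x \<in> (+) x ` ?V"
      by (rule block_exchange[OF R k, where z = "M w"]) blast
    obtain D where D: "\<And>v. v \<in> effdom J \<longleftrightarrow> (\<forall>j\<in>{1..m}. R j v \<in> D j)"
      by (rule block_separable_effdom[OF sep]) blast
    \<comment> \<open>Block \<open>k\<close> of \<open>T x\<close> comes from \<open>M w\<close> and
      the others from \<open>x\<close>, both in the domain, so every blockwise condition
      holds.\<close>
    have "T ` effdom J \<subseteq> effdom J"
      using exact_minimization_mem(2)[OF M w] by (auto simp: D T(2))
    then have "continuous_on (effdom J) (\<lambda>x. J (T x))"
      by (intro continuous_on_compose2[OF cont] continuous_on_subset[OF T(1)]) auto
    then have "((\<lambda>x. J (T x)) \<longlongrightarrow> J (T w)) ?F"
      using w by (simp add: continuous_on_def)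
    moreover obtain v where v: "v \<in> ?V" "M w = w + v"
      using exact_minimization_mem(1)[OF M w] by auto
    \<comment> \<open>\<open>M w\<close> differs from \<open>w\<close> by an element of
      \<open>?V\<close>, hence only in block \<open>k\<close>, which is the one that
      \<open>T\<close> replaces.\<close>
    have "T w = M w"
      using v by (intro block_structure_eqI[OF R])
        (auto simp: T(2) mem_block_space_iff[OF R k] block_structure_add[OF R])
    ultimately have "\<forall>\<^sub>F x in ?F. J (T x) < c"
      using c by (intro order_tendstoD) auto
    with dom show "\<forall>\<^sub>F w' in ?F. J (M w') < c"
      by eventually_elim (use exact_minimization_le[OF M _ T(3)] in \<open>rule le_less_trans\<close>)
  qed
qed

theorem lemma5p1:
  fixes J :: "real ^ 'n \<Rightarrow> ereal"
    and R :: "nat \<Rightarrow> real ^ 'n \<Rightarrow> nat \<Rightarrow> real"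
    and N :: "nat \<Rightarrow> nat"
    and m k :: nat
    and V :: "(real ^ 'n) set"
    and Mex :: "real ^ 'n \<Rightarrow> real ^ 'n"
  assumes "proper_on UNIV J"
    and "coercive J"
    and "lsc_map euclidean J"
    and "continuous_on (effdom J) J"
    and "convex (effdom J)"
    and "block_separable_nonsmooth m N R J"
    and "k \<in> {1..m}"
    and "V = block_space m N R k"
    and "exact_minimization J V Mex"
  shows "op_monotone J Mex Mex \<and> op_continuous J Mex \<and> op_stable J V Mex
    \<and> continuous_on (effdom J) (\<lambda>w. J (Mex w))"
proof -
  have R: "block_structure m N R"
    using assms(6) by (simp add: block_separable_nonsmooth_def)
  have "w \<in> (+) w ` V" for w
    using subspace_0[OF subspace_block_space[OF R assms(7)]] assms(8)
    by (intro image_eqI[of _ _ 0]) auto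
  then have "op_monotone J Mex Mex"
    using exact_minimization_le[OF assms(9)] by (auto simp: op_monotone_def)
  moreover have "op_stable J V Mex"
    unfolding op_stable_def
  proof (intro ballI impI)
    fix w assume w: "w \<in> effdom J" and "\<not> global_minimizer_in J ((+) w ` V) w"
    \<comment> \<open>As \<open>w\<close> belongs to its own coset, it can fail to be a minimizer
      only through a point of strictly smaller energy.\<close>
    then obtain y where "y \<in> (+) w ` V" "J y < J w"
      using \<open>w \<in> (+) w ` V\<close> by (auto simp: global_minimizer_in_def is_arg_min_def)
    then show "J (Mex w) < J w"
      using exact_minimization_le[OF assms(9) w] by (meson le_less_trans)
  qed
  moreover have "continuous_on (effdom J) (\<lambda>w. J (Mex w))"
    by (rule continuous_on_minimal_energy[OF assms(2-4,6,7) assms(9)[unfolded assms(8)]])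
  ultimately show ?thesis
    by (simp add: op_continuous_def comp_def)
qed

end
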